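(* Let $\mathcal{N}=\{1,\dots,p\}$, let $\mathcal{S}$ be a simplicial complex on $\mathcal{N}$, and let $\bar{\mathcal{S}}$ be its complementary complex. Let $X$ be a random vector in $\mathbb{R}^p$ with a strictly positive, $p+1$ times continuously differentiable density $f_X$, and let $g=\log f_X$. Then $g$ is hierarchical based on $\mathcal{S}$, i.e. there exist functions $h_J:\mathbb{R}^J\to\mathbb{R}$ ($J\in\mathcal{S}$) with $$g(x)=\sum_{J\in\mathcal{S}}h_J(x_J)\quad\text{for all }x\in\mathbb{R}^p,$$ if and only if $$\kappa_K^x=0\quad\text{for all }x\in\mathbb{R}^p\text{ and all }K\in\bar{\mathcal{S}}.$$
   Context: A simplicial complex $\mathcal{S}$ on $\mathcal{N}=\{1,\dots,p\}$ is a collection of subsets of $\mathcal{N}$ closed under taking subsets: if $J\in\mathcal{S}$ and $K\subseteq J$ then $K\in\mathcal{S}$. The complementary complex $\bar{\mathcal{S}}$ is the collection of all subsets $K\subseteq\mathcal{N}$ with $K\notin\mathcal{S}$. For $J\subseteq\mathcal{N}$, $x_J\in\mathbb{R}^J$ denotes the canonical projection of $x\in\mathbb{R}^p$ onto the coordinates indexed by $J$. For $K\subseteq\mathcal{N}$, $D^K$ is the mixed partial derivative operator that differentiates exactly once with respect to each $x_i$, $i\in K$ (with $D^\emptyset g=g$). The (square-free) differential cumulant associated with $K$ at $x$ is $\kappa_K^x=D^Kg(x)=D^K\log f_X(x)$. *)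

theory Defs
  imports "HOL-Probability.Probability"
begin

definition abstract_simplicial_complex :: "'n set set \<Rightarrow> bool" where
  "abstract_simplicial_complex S \<longleftrightarrow> (\<forall>J\<in>S. \<forall>K. K \<subseteq> J \<longrightarrow> K \<in> S)"

definition complementary_complex :: "'n set set \<Rightarrow> 'n set set" where
  "complementary_complex S = {K. K \<notin> S}"

text \<open>Points of \<open>\<real>\<^sup>J\<close> are represented by functions that are \<open>undefined\<close> outside \<open>J\<close>,
  i.e. by the elements of \<open>J \<rightarrow>\<^sub>E UNIV\<close>.\<close>

definition coord_proj :: "'n::finite set \<Rightarrow> real ^ 'n \<Rightarrow> 'n \<Rightarrow> real" where
  "coord_proj J x = (\<lambda>i\<in>J. x $ i)"

text \<open>Nothing is required of the functions \<open>h J\<close>; in particular they need not be continuous.\<close>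

definition hierarchical :: "'n::finite set set \<Rightarrow> (real ^ 'n \<Rightarrow> real) \<Rightarrow> bool" where
  "hierarchical S g \<longleftrightarrow>
    (\<exists>h :: 'n set \<Rightarrow> ('n \<Rightarrow> real) \<Rightarrow> real. \<forall>x. g x = (\<Sum>J\<in>S. h J (coord_proj J x)))"

definition partial_deriv :: "'n::finite \<Rightarrow> (real ^ 'n \<Rightarrow> real) \<Rightarrow> real ^ 'n \<Rightarrow> real" where
  "partial_deriv i f x = deriv (\<lambda>t. f (x + t *\<^sub>R axis i 1)) 0"

text \<open>\<open>k\<close> times continuously differentiable: all iterated partial derivatives of order at most
  \<open>k\<close> exist everywhere and are continuous. Existence has to be demanded separately because
  \<open>deriv\<close> is total.\<close>

primrec times_cont_diff :: "nat \<Rightarrow> (real ^ 'n::finite \<Rightarrow> real) \<Rightarrow> bool" where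
  "times_cont_diff 0 f \<longleftrightarrow> continuous_on UNIV f"
| "times_cont_diff (Suc k) f \<longleftrightarrow> continuous_on UNIV f \<and>
    (\<forall>i. (\<forall>x. (\<lambda>t. f (x + t *\<^sub>R axis i 1)) differentiable (at 0)) \<and>
         times_cont_diff k (partial_deriv i f))"

text \<open>The linear order on the index type (that of \<open>1, \<dots>, p\<close>) only serves to fix an order of
  differentiation; for functions that are \<open>card K\<close> times continuously differentiable all orders
  give the same result.\<close>

definition mixed_partial ::
    "'n::{finite,linorder} set \<Rightarrow> (real ^ 'n::_ \<Rightarrow> real) \<Rightarrow> real ^ 'n::_ \<Rightarrow> real" where
  "mixed_partial K f = foldr partial_deriv (sorted_list_of_set K) f"

definition differential_cumulant ::
    "(real ^ 'n::{finite,linorder} \<Rightarrow> real) \<Rightarrow> 'n set \<Rightarrow> real ^ 'n::_ \<Rightarrow> real" where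
  "differential_cumulant f K x = mixed_partial K (\<lambda>y. ln (f y)) x"

end

theory Submission imports Defs begin

text \<open>The discrete counterpart of \<open>D\<^sup>K\<close> is the mixed difference \<open>\<Delta>\<^sub>K\<close>, the product over
  \<open>i \<in> K\<close> of the operators that subtract from a function its restriction to \<open>x\<^sub>i = 0\<close>. Every \<open>u\<close>
  telescopes into the sum over all \<open>J\<close> of \<open>\<Delta>\<^sub>J u\<close> evaluated with the coordinates outside \<open>J\<close> set
  to 0, so \<open>u\<close> is hierarchical based on \<open>\<S>\<close> iff \<open>\<Delta>\<^sub>K u = 0\<close> for all \<open>K \<notin> \<S>\<close>; no regularity
  is used here, so the functions \<open>h\<^sub>J\<close> may be arbitrary. For smooth \<open>u\<close>, \<open>\<Delta>\<^sub>K u = 0\<close> iff \<open>D\<^sup>K u = 0\<close>: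
  restricting to \<open>x\<^sub>i = 0\<close> commutes with \<open>\<partial>\<^sub>j\<close> for \<open>j \<noteq> i\<close> and is annihilated by \<open>\<partial>\<^sub>i\<close>, so
  \<open>D\<^sup>K \<Delta>\<^sub>K u = D\<^sup>K u\<close>, and a function with \<open>\<partial>\<^sub>i u = 0\<close> agrees with its restriction.\<close>

section \<open>Mixed differences\<close>

definition zero_on :: "'n::finite set \<Rightarrow> real ^ 'n \<Rightarrow> real ^ 'n" where
  "zero_on A x = (\<chi> i. if i \<in> A then 0 else x $ i)"

definition diff_at_zero :: "'n::finite \<Rightarrow> (real ^ 'n \<Rightarrow> real) \<Rightarrow> real ^ 'n \<Rightarrow> real" where
  "diff_at_zero i u x = u x - u (zero_on {i} x)"

text \<open>Expanded product of the commuting operators \<open>diff_at_zero i\<close> for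
  \<open>i\<close> in \<open>K\<close>. The signed sum over subsets avoids choosing an order on
  \<open>K\<close>.\<close>

definition mixed_diff :: "'n::finite set \<Rightarrow> (real ^ 'n \<Rightarrow> real) \<Rightarrow> real ^ 'n \<Rightarrow> real" where
  "mixed_diff K u x = (\<Sum>A\<in>Pow K. (-1) ^ card A * u (zero_on A x))"

lemma zero_on_empty [simp]: "zero_on {} x = x"
  by (simp add: zero_on_def)

lemma zero_on_zero_on: "zero_on A (zero_on B x) = zero_on (A \<union> B) x"
  by (auto simp: zero_on_def vec_eq_iff)

lemma mixed_diff_empty [simp]: "mixed_diff {} u = u"
  by (simp add: mixed_diff_def fun_eq_iff)

lemma mixed_diff_zero [simp]: "mixed_diff K (\<lambda>x. 0) = (\<lambda>x. 0)"
  by (simp add: mixed_diff_def fun_eq_iff)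

lemma mixed_diff_sum:
  "mixed_diff K (\<lambda>x. \<Sum>j\<in>I. u j x) x = (\<Sum>j\<in>I. mixed_diff K (u j) x)"
  unfolding mixed_diff_def sum_distrib_left by (rule sum.swap)

lemma sum_Pow_insert:
  fixes \<phi> :: "'b set \<Rightarrow> 'c::comm_monoid_add"
  assumes "finite K" "a \<notin> K"
  shows "(\<Sum>A\<in>Pow (insert a K). \<phi> A) = (\<Sum>A\<in>Pow K. \<phi> A + \<phi> (insert a A))"
proof -
  have "inj_on (insert a) (Pow K)"
    using assms(2) by (auto simp: inj_on_def insert_eq_iff)
  moreover have "Pow K \<inter> insert a ` Pow K = {}"
    using assms(2) by auto
  ultimately show ?thesis
    using assms(1) by (simp add: Pow_insert sum.union_disjoint sum.reindex sum.distrib)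
qed

text \<open>Subsets without \<open>a\<close> pair with those containing \<open>a\<close>, and the
  signs in a pair are opposite. This is the recursion behind all inductions on
  \<open>K\<close>.\<close>

lemma mixed_diff_insert:
  assumes "a \<notin> K"
  shows "mixed_diff (insert a K) u = mixed_diff K (diff_at_zero a u)"
proof
  fix x
  have "mixed_diff (insert a K) u x =
      (\<Sum>A\<in>Pow K. (-1) ^ card A * u (zero_on A x)
        + (-1) ^ card (insert a A) * u (zero_on (insert a A) x))"
    unfolding mixed_diff_def using assms by (intro sum_Pow_insert) auto
  also have "\<dots> = (\<Sum>A\<in>Pow K. (-1) ^ card A * diff_at_zero a u (zero_on A x))"
  proof (intro sum.cong refl)
    fix A assume "A \<in> Pow K"
    then have "a \<notin> A" using assms by auto
    then show "(-1) ^ card A * u (zero_on A x)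
        + (-1) ^ card (insert a A) * u (zero_on (insert a A) x)
        = (-1) ^ card A * diff_at_zero a u (zero_on A x)"
      by (simp add: diff_at_zero_def zero_on_zero_on algebra_simps)
  qed
  finally show "mixed_diff (insert a K) u x = mixed_diff K (diff_at_zero a u) x"
    by (simp add: mixed_diff_def)
qed

lemma mixed_diff_diff_at_zero:
  "mixed_diff K (diff_at_zero a u) = diff_at_zero a (mixed_diff K u)"
  by (simp add: fun_eq_iff mixed_diff_def diff_at_zero_def zero_on_zero_on Un_commute
      algebra_simps sum_subtractf)

lemma mixed_diff_eq_zero:
  assumes "i \<in> K" "\<And>x. u (zero_on {i} x) = u x"
  shows "mixed_diff K u = (\<lambda>x. 0)"
proof -
  have "diff_at_zero i u = (\<lambda>x. 0)"
    using assms(2) by (simp add: diff_at_zero_def fun_eq_iff)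
  then show ?thesis
    using mixed_diff_insert[of i "K - {i}" u] assms(1) by (simp add: insert_absorb)
qed

lemma mixed_diff_telescope:
  "u x = (\<Sum>J\<in>Pow A. mixed_diff J u (zero_on (A - J) x))"
proof (induction A rule: finite_induct[OF finite])
  case 1
  then show ?case by simp
next
  case (2 a A)
  have "(\<Sum>J\<in>Pow (insert a A). mixed_diff J u (zero_on (insert a A - J) x)) =
      (\<Sum>J\<in>Pow A. mixed_diff J u (zero_on (insert a A - J) x)
        + mixed_diff (insert a J) u (zero_on (insert a A - insert a J) x))"
    using 2 by (intro sum_Pow_insert) auto
  also have "\<dots> = (\<Sum>J\<in>Pow A. mixed_diff J u (zero_on (A - J) x))"
  proof (intro sum.cong refl)
    fix J assume "J \<in> Pow A"
    \<comment> \<open>The two evaluation points differ only by zeroing coordinate \<open>a\<close>,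
      so the term for \<open>insert a J\<close> is a difference of values of
      \<open>mixed_diff J u\<close> and cancels the term for \<open>J\<close>.\<close>
    then have "a \<notin> J" using 2 by auto
    moreover from this have "insert a A - insert a J = A - J" "insert a A - J = insert a (A - J)"
      using 2 by auto
    ultimately show "mixed_diff J u (zero_on (insert a A - J) x)
        + mixed_diff (insert a J) u (zero_on (insert a A - insert a J) x)
        = mixed_diff J u (zero_on (A - J) x)"
      by (simp add: mixed_diff_insert mixed_diff_diff_at_zero diff_at_zero_def zero_on_zero_on)
  qed
  finally show ?case using 2 by simp
qed

section \<open>Hierarchical functions and vanishing mixed differences\<close>

lemma hierarchical_iff_mixed_diff:
  fixes u :: "real ^ 'n::finite \<Rightarrow> real"
  assumes "abstract_simplicial_complex S"
  shows "hierarchical S u \<longleftrightarrow> (\<forall>K. K \<notin> S \<longrightarrow> mixed_diff K u = (\<lambda>x. 0))"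
proof (intro iffI allI impI)
  fix K assume K: "K \<notin> S" and "hierarchical S u"
  then obtain h where u: "u = (\<lambda>x. \<Sum>J\<in>S. h J (coord_proj J x))"
    by (auto simp: hierarchical_def)
  have "mixed_diff K (\<lambda>x. h J (coord_proj J x)) = (\<lambda>x. 0)" if J: "J \<in> S" for J
  proof -
    \<comment> \<open>\<open>K\<close> is no subset of \<open>J\<close>, as \<open>S\<close> is
      closed under subsets; the summand for \<open>J\<close> ignores such an
      \<open>i\<close>.\<close>
    obtain i where i: "i \<in> K" "i \<notin> J"
      using J K assms unfolding abstract_simplicial_complex_def by blast
    then have "coord_proj J (zero_on {i} x) = coord_proj J x" for x :: "real ^ 'n"
      by (auto simp: coord_proj_def zero_on_def restrict_def fun_eq_iff)
    then show ?thesis by (intro mixed_diff_eq_zero[OF i(1)]) simp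
  qed
  then show "mixed_diff K u = (\<lambda>x. 0)"
    unfolding u fun_eq_iff mixed_diff_sum by simp
next
  assume zero: "\<forall>K. K \<notin> S \<longrightarrow> mixed_diff K u = (\<lambda>x. 0)"
  \<comment> \<open>Extending \<open>y\<close> by 0 turns \<open>coord_proj J x\<close> into
    \<open>zero_on (- J) x\<close>, so \<open>h J\<close> is the telescoping term of
    \<open>J\<close>.\<close>
  define h where "h J y = mixed_diff J u (\<chi> i. if i \<in> J then y i else 0)"
    for J :: "'n set" and y
  have "u x = (\<Sum>J\<in>S. h J (coord_proj J x))" for x
  proof -
    have "u x = (\<Sum>J\<in>UNIV. mixed_diff J u (zero_on (- J) x))"
      using mixed_diff_telescope[of u x UNIV] by (simp add: Compl_eq_Diff_UNIV)
    also have "\<dots> = (\<Sum>J\<in>S. mixed_diff J u (zero_on (- J) x))"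
      using zero by (intro sum.mono_neutral_right) auto
    also have "\<dots> = (\<Sum>J\<in>S. h J (coord_proj J x))"
      unfolding h_def
      by (intro sum.cong refl arg_cong[where f = "mixed_diff _ u"])
        (auto simp: zero_on_def coord_proj_def vec_eq_iff)
    finally show ?thesis .
  qed
  then show "hierarchical S u"
    unfolding hierarchical_def by blast
qed

section \<open>Continuously differentiable functions\<close>

lemma times_cont_diff_continuous: "times_cont_diff k u \<Longrightarrow> continuous_on UNIV u"
  by (cases k) auto

lemma times_cont_diff_Suc_D: "times_cont_diff (Suc k) u \<Longrightarrow> times_cont_diff k u"
  by (induction k arbitrary: u) auto

lemma times_cont_diff_mono: "k \<le> m \<Longrightarrow> times_cont_diff m u \<Longrightarrow> times_cont_diff k u"
  by (induction rule: dec_induct) (auto dest: times_cont_diff_Suc_D simp del: times_cont_diff.simps)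

lemma times_cont_diff_has_partial:
  assumes "times_cont_diff (Suc k) u"
  shows "((\<lambda>t. u (x + t *\<^sub>R axis i 1)) has_field_derivative partial_deriv i u x) (at 0)"
  using assms unfolding partial_deriv_def by (simp add: DERIV_deriv_iff_real_differentiable)

lemma partial_deriv_eqI:
  "((\<lambda>t. u (x + t *\<^sub>R axis i 1)) has_field_derivative d) (at 0) \<Longrightarrow> partial_deriv i u x = d"
  unfolding partial_deriv_def by (rule DERIV_imp_deriv)

text \<open>Allows the partial derivatives to be given by explicit formulas \<open>D i\<close>, so
  that calculus rules yield existence and value at once.\<close>

lemma times_cont_diff_SucI:
  assumes "continuous_on UNIV u"
    and "\<And>i x. ((\<lambda>t. u (x + t *\<^sub>R axis i 1)) has_field_derivative D i x) (at 0)"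
    and "\<And>i. times_cont_diff k (D i)"
  shows "times_cont_diff (Suc k) u"
proof -
  have "partial_deriv i u = D i" for i
    using partial_deriv_eqI[OF assms(2)] by (simp add: fun_eq_iff)
  then show ?thesis
    using assms by (auto simp: real_differentiable_def)
qed

section \<open>Closure properties, up to the logarithm\<close>

lemma times_cont_diff_const: "times_cont_diff k (\<lambda>x. c)"
proof (induction k arbitrary: c)
  case (Suc k)
  show ?case
    by (rule times_cont_diff_SucI[where D = "\<lambda>i x. 0"]) (auto intro: Suc)
qed simp

lemma times_cont_diff_add:
  assumes "times_cont_diff k u" "times_cont_diff k v"
  shows "times_cont_diff k (\<lambda>x. u x + v x)"
  using assms
proof (induction k arbitrary: u v)
  case (Suc k)
  show ?case
  proof (rule times_cont_diff_SucI)
    show "((\<lambda>t. u (x + t *\<^sub>R axis i 1) + v (x + t *\<^sub>R axis i 1)) has_field_derivative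
        partial_deriv i u x + partial_deriv i v x) (at 0)" for i x
      by (intro DERIV_add times_cont_diff_has_partial[OF Suc.prems(1)]
          times_cont_diff_has_partial[OF Suc.prems(2)])
  qed (use Suc in \<open>auto intro: continuous_intros\<close>)
qed (auto intro: continuous_intros)

lemma times_cont_diff_mult:
  assumes "times_cont_diff k u" "times_cont_diff k v"
  shows "times_cont_diff k (\<lambda>x. u x * v x)"
  using assms
proof (induction k arbitrary: u v)
  case (Suc k)
  show ?case
  proof (rule times_cont_diff_SucI)
    show "((\<lambda>t. u (x + t *\<^sub>R axis i 1) * v (x + t *\<^sub>R axis i 1)) has_field_derivative
        partial_deriv i u x * v x + partial_deriv i v x * u x) (at 0)" for i x
      using DERIV_mult[OF times_cont_diff_has_partial[OF Suc.prems(1)]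
          times_cont_diff_has_partial[OF Suc.prems(2)]] by simp
    show "times_cont_diff k (\<lambda>x. partial_deriv i u x * v x + partial_deriv i v x * u x)" for i
      using Suc.prems times_cont_diff_Suc_D[OF Suc.prems(1)] times_cont_diff_Suc_D[OF Suc.prems(2)]
      by (auto intro!: times_cont_diff_add Suc.IH)
  qed (use Suc.prems in \<open>auto intro: continuous_intros\<close>)
qed (auto intro: continuous_intros)

lemma times_cont_diff_inverse:
  assumes "times_cont_diff k u" "\<And>x. u x \<noteq> 0"
  shows "times_cont_diff k (\<lambda>x. inverse (u x))"
  using assms
proof (induction k arbitrary: u)
  case (Suc k)
  show ?case
  proof (rule times_cont_diff_SucI)
    show "((\<lambda>t. inverse (u (x + t *\<^sub>R axis i 1))) has_field_derivative
        (- 1) * (inverse (u x) * partial_deriv i u x * inverse (u x))) (at 0)" for i x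
      using DERIV_inverse'[OF times_cont_diff_has_partial[OF Suc.prems(1)]] Suc.prems(2) by simp
    \<comment> \<open>Written as a product, the derivative needs only the induction hypothesis for
      the inverse and closure under multiplication.\<close>
    show "times_cont_diff k
        (\<lambda>x. (- 1) * (inverse (u x) * partial_deriv i u x * inverse (u x)))" for i
      using Suc.prems times_cont_diff_Suc_D[OF Suc.prems(1)]
      by (intro times_cont_diff_mult times_cont_diff_const Suc.IH) auto
  qed (use Suc.prems in \<open>auto intro: continuous_intros\<close>)
qed (auto intro: continuous_intros)

lemma times_cont_diff_ln:
  assumes "times_cont_diff k u" "\<And>x. u x > 0"
  shows "times_cont_diff k (\<lambda>x. ln (u x))"
proof (cases k)
  case 0
  then show ?thesis
    using assms by (auto intro!: continuous_intros simp: less_imp_neq[symmetric])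
next
  case (Suc m)
  have u: "times_cont_diff (Suc m) u" using assms Suc by simp
  have pos: "u x \<noteq> 0" for x using assms(2)[of x] by simp
  show ?thesis unfolding Suc
  proof (rule times_cont_diff_SucI)
    show "continuous_on UNIV (\<lambda>x. ln (u x))"
      using u pos by (auto intro!: continuous_intros)
    show "((\<lambda>t. ln (u (x + t *\<^sub>R axis i 1))) has_field_derivative
        inverse (u x) * partial_deriv i u x) (at 0)" for i x
      using times_cont_diff_has_partial[OF u, of x i] assms(2)[of x]
      by (auto intro!: derivative_eq_intros simp: divide_inverse)
    show "times_cont_diff m (\<lambda>x. inverse (u x) * partial_deriv i u x)" for i
      using u pos times_cont_diff_Suc_D[OF u]
      by (intro times_cont_diff_mult times_cont_diff_inverse) auto
  qed
qed

section \<open>Restriction to a coordinate hyperplane and partial derivatives\<close>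

lemma zero_on_singleton: "zero_on {i} x = x + (- x $ i) *\<^sub>R axis i 1"
  by (auto simp: zero_on_def vec_eq_iff axis_def)

lemma zero_on_add_axis_same: "zero_on {i} (x + t *\<^sub>R axis i 1) = zero_on {i} x"
  by (auto simp: zero_on_def vec_eq_iff axis_def)

lemma zero_on_add_axis_other:
  "i \<noteq> j \<Longrightarrow> zero_on {i} (x + t *\<^sub>R axis j 1) = zero_on {i} x + t *\<^sub>R axis j 1"
  by (auto simp: zero_on_def vec_eq_iff axis_def)

lemma has_partial_diff_at_zero:
  assumes "times_cont_diff (Suc k) u"
  shows "((\<lambda>t. diff_at_zero i u (x + t *\<^sub>R axis j 1)) has_field_derivative
    (if i = j then partial_deriv j u else diff_at_zero i (partial_deriv j u)) x) (at 0)"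
proof (cases "i = j")
  case True
  then show ?thesis
    using DERIV_diff[OF times_cont_diff_has_partial[OF assms, of x j] DERIV_const]
    by (simp add: diff_at_zero_def zero_on_add_axis_same)
next
  case False
  then show ?thesis
    using DERIV_diff[OF times_cont_diff_has_partial[OF assms, of x j]
        times_cont_diff_has_partial[OF assms, of "zero_on {i} x" j]]
    by (simp add: diff_at_zero_def zero_on_add_axis_other)
qed

lemma partial_deriv_diff_at_zero:
  assumes "times_cont_diff (Suc k) u"
  shows "partial_deriv j (diff_at_zero i u) =
    (if i = j then partial_deriv j u else diff_at_zero i (partial_deriv j u))"
  using partial_deriv_eqI[OF has_partial_diff_at_zero[OF assms]] by blast

lemma continuous_on_diff_at_zero:
  assumes "continuous_on UNIV u"
  shows "continuous_on UNIV (diff_at_zero i u)"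
proof -
  have "continuous_on UNIV (zero_on {i})"
    unfolding zero_on_singleton[abs_def] by (intro continuous_intros)
  then have "continuous_on UNIV (\<lambda>x. u (zero_on {i} x))"
    using continuous_on_compose2[OF assms] by simp
  then show ?thesis
    using assms unfolding diff_at_zero_def[abs_def] by (intro continuous_intros)
qed

lemma times_cont_diff_diff_at_zero:
  "times_cont_diff k u \<Longrightarrow> times_cont_diff k (diff_at_zero i u)"
proof (induction k arbitrary: u)
  case (Suc k)
  show ?case
    using Suc by (intro times_cont_diff_SucI[OF _ has_partial_diff_at_zero[OF Suc.prems]])
      (auto intro: continuous_on_diff_at_zero)
qed (auto intro: continuous_on_diff_at_zero)

lemma partial_deriv_zero_imp:
  assumes "times_cont_diff (Suc k) u" "partial_deriv i u = (\<lambda>x. 0)"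
  shows "diff_at_zero i u = (\<lambda>x. 0)"
proof
  fix x
  \<comment> \<open>Moving the base point to \<open>x + s *\<^sub>R axis i 1\<close> gives the
    derivative at every \<open>s\<close>, so \<open>u\<close> is constant on the line, which meets
    the hyperplane at \<open>t = - x $ i\<close>.\<close>
  have "((\<lambda>t. u (x + t *\<^sub>R axis i 1)) has_field_derivative 0) (at s)" for s
    using times_cont_diff_has_partial[OF assms(1), of "x + s *\<^sub>R axis i 1" i] assms(2)
    by (subst DERIV_shift[of _ _ 0 s, simplified]) (simp add: algebra_simps)
  then have "u (x + (- x $ i) *\<^sub>R axis i 1) = u (x + 0 *\<^sub>R axis i 1)"
    by (intro DERIV_isconst_all allI)
  then show "diff_at_zero i u x = 0"
    unfolding diff_at_zero_def zero_on_singleton by simp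
qed

section \<open>Mixed partial derivatives and mixed differences\<close>

lemma partial_deriv_zero [simp]: "partial_deriv i (\<lambda>x. 0) = (\<lambda>x. 0)"
  by (simp add: partial_deriv_def fun_eq_iff)

lemma foldr_partial_deriv_zero [simp]: "foldr partial_deriv L (\<lambda>x. 0) = (\<lambda>x. 0)"
  by (induction L) auto

lemma times_cont_diff_foldr_partial_deriv:
  "times_cont_diff (k + length L) u \<Longrightarrow> times_cont_diff k (foldr partial_deriv L u)"
proof (induction L arbitrary: k)
  case (Cons j L)
  then have "times_cont_diff (Suc k) (foldr partial_deriv L u)"
    by (simp del: times_cont_diff.simps)
  then show ?case by simp
qed simp

text \<open>The difference moves outward through the derivatives in other directions and is absorbed
  when it meets the one in direction \<open>i\<close>.\<close>

lemma foldr_partial_deriv_diff_at_zero: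
  assumes "times_cont_diff (length L) u" "distinct L"
  shows "foldr partial_deriv L (diff_at_zero i u) =
    (if i \<in> set L then foldr partial_deriv L u else diff_at_zero i (foldr partial_deriv L u))"
  using assms
proof (induction L)
  case (Cons j L)
  have "times_cont_diff (Suc 0) (foldr partial_deriv L u)"
    using Cons.prems by (intro times_cont_diff_foldr_partial_deriv) simp
  from partial_deriv_diff_at_zero[OF this, of j i] show ?case
    using Cons times_cont_diff_Suc_D[of "length L" u] by auto
qed simp

lemma foldr_partial_deriv_mixed_diff:
  assumes "times_cont_diff (length L) u" "distinct L" "K \<subseteq> set L"
  shows "foldr partial_deriv L (mixed_diff K u) = foldr partial_deriv L u"
  using finite[of K] assms
proof (induction K arbitrary: u rule: finite_induct)
  case (insert a K)
  then show ?case
    by (simp add: mixed_diff_insert times_cont_diff_diff_at_zero foldr_partial_deriv_diff_at_zero)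
qed simp

text \<open>Discretizes one derivative at a time, starting with the outermost one.\<close>

lemma foldr_partial_deriv_zero_imp:
  assumes "times_cont_diff (length L) u" "distinct L" "foldr partial_deriv L u = (\<lambda>x. 0)"
  shows "mixed_diff (set L) u = (\<lambda>x. 0)"
  using assms
proof (induction L arbitrary: u)
  case (Cons j L)
  have "times_cont_diff (Suc 0) (foldr partial_deriv L u)"
    using Cons.prems by (intro times_cont_diff_foldr_partial_deriv) simp
  from partial_deriv_zero_imp[OF this]
  have "diff_at_zero j (foldr partial_deriv L u) = (\<lambda>x. 0)"
    using Cons.prems(3) by simp
  moreover have u: "times_cont_diff (length L) u"
    using Cons.prems(1) times_cont_diff_Suc_D[of "length L" u] by simp
  \<comment> \<open>As \<open>j\<close> is not in \<open>L\<close>, the difference passes inside the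
    remaining derivatives, and the induction hypothesis applies to
    \<open>diff_at_zero j u\<close>.\<close>
  ultimately have "foldr partial_deriv L (diff_at_zero j u) = (\<lambda>x. 0)"
    using Cons.prems by (simp add: foldr_partial_deriv_diff_at_zero)
  then show ?case
    using Cons u by (simp add: mixed_diff_insert times_cont_diff_diff_at_zero)
qed simp

lemma mixed_partial_zero_iff:
  assumes "times_cont_diff (card K) u"
  shows "mixed_partial K u = (\<lambda>x. 0) \<longleftrightarrow> mixed_diff K u = (\<lambda>x. 0)"
proof -
  define L where "L = sorted_list_of_set K"
  have L: "times_cont_diff (length L) u" "distinct L" "set L = K"
    using assms by (auto simp: L_def)
  \<comment> \<open>Hence a vanishing mixed difference forces the mixed partial derivative to
    vanish.\<close>
  then have "mixed_partial K u = foldr partial_deriv L (mixed_diff K u)"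
    by (simp add: mixed_partial_def L_def[symmetric] foldr_partial_deriv_mixed_diff)
  then show ?thesis
    using foldr_partial_deriv_zero_imp[OF L(1,2)] L(3)
    by (auto simp: mixed_partial_def L_def[symmetric])
qed

theorem theorem5:
  fixes S :: "'n::{finite,linorder} set set"
    and M :: "'a measure"
    and X :: "'a \<Rightarrow> real ^ 'n::_"
    and f g :: "real ^ 'n::_ \<Rightarrow> real"
  assumes "abstract_simplicial_complex S"
    and "prob_space M"
    and "distributed M lborel X (\<lambda>x. ennreal (f x))"
    and "\<And>x. f x > 0"
    and "times_cont_diff (CARD('n) + 1) f"
    and "g = (\<lambda>x. ln (f x))"
  shows "hierarchical S g \<longleftrightarrow>
    (\<forall>x. \<forall>K\<in>complementary_complex S. differential_cumulant f K x = 0)"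
proof -
  \<comment> \<open>Every \<open>K\<close> has at most \<open>CARD('n)\<close> elements, so the
    smoothness of \<open>f\<close> covers all mixed partials of its logarithm.\<close>
  have "times_cont_diff (card K) g" for K :: "'n set"
    unfolding assms(6) using card_mono[of UNIV K]
    by (intro times_cont_diff_ln times_cont_diff_mono[OF _ assms(5)] assms(4)) simp
  then have "mixed_partial K g = (\<lambda>x. 0) \<longleftrightarrow> mixed_diff K g = (\<lambda>x. 0)" for K
    by (rule mixed_partial_zero_iff)
  then show ?thesis
    unfolding hierarchical_iff_mixed_diff[OF assms(1)] differential_cumulant_def
      complementary_complex_def assms(6)[symmetric]
    by (auto simp: fun_eq_iff)
qed

end
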